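(* Let $k,\ N$ be any natural numbers greater $1$. Then for $\mathrm{Re} (x)>0$, we have \begin{align*} \mathfrak{F}_{k,N}(x)=\frac{(-1)^k}{N}x^{\frac{k-1}{N}}\sum_{\substack{j=-(N-1)\\ j\equiv N-1 \ (\mathrm{mod}\ 2)}}^{N-1}e^{\frac{i\pi j(k-1)}{N}}\mathfrak{F}_{\frac{N+k-1}{N},\frac{1}{N}}\left(\frac{e^{-\frac{i\pi j}{N}}}{x^{1/N}}\right)-\frac{x^{\frac{k-1}{N}}}{N}\mathscr{R}_{N,k}(x), \end{align*} where, for $N\nmid (k-1)$ and $N\nmid k$, \begin{align*} \mathscr{R}_{N,k}(x)&=\frac{N}{2}x^{\frac{1-k-N}{N}}\zeta(k+N)-\frac{\pi\zeta\left(\frac{N+k-1}{N}\right)}{\sin\left(\frac{\pi}{N}(k-1)\right)}-Nx^{\frac{1-k}{N}}\left(N\zeta'(k)-(\gamma+\log x)\zeta(k)\right)\nonumber\\ &\qquad +N\sum_{j=1}^{\lfloor\frac{k-1}{N}\rfloor}(-1)^j\zeta(1+j)\zeta(k-N)x^{\frac{k-1}{N}+j}, \end{align*} and, for $N|k$, \begin{align*} \mathscr{R}_{N,k}(x)&=\frac{N}{2}x^{\frac{1-k-N}{N}}\zeta(k+N)-\frac{\pi\zeta\left(\frac{N+k-1}{N}\right)}{\sin\left(\frac{\pi}{N}(k-1)\right)}-Nx^{\frac{1-k}{N}}\left(N\zeta'(k)-(\gamma+\log x)\zeta(k)\right)\nonumber\\ &\quad-\frac{N}{2}(-1)^{\frac{k}{N}}x^{\frac{1}{N}}\zeta\left(\frac{k+N}{N}\right)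 +N\sum_{j=1}^{\lfloor\frac{k-1}{N}\rfloor}(-1)^j\zeta(1+j)\zeta(k-N)x^{\frac{k-1}{N}+j}, \end{align*} and, for $N|(k-1)$, \begin{align*} \mathscr{R}_{N,k}(x)&=\frac{N}{2}x^{\frac{1-k-N}{N}}\zeta(k+N)+(-1)^{\frac{k-1}{N}}\left((N\gamma-\log x)\zeta\left(\frac{N+k-1}{N}\right)-\zeta'\left(\frac{N+k-1}{N}\right)\right)\nonumber\\ &\quad -Nx^{\frac{1-k}{N}}\left(N\zeta'(k)-(\gamma+\log x)\zeta(k)\right)+N\sum_{j=1}^{\lfloor\frac{k-1}{N}\rfloor-1}(-1)^j\zeta(1+j)\zeta(k-N)x^{\frac{k-1}{N}+j}. \end{align*}
   Context: For $x\in\mathbb{C}\backslash(-\infty,0]$ and real $k,N$ with $k+2N>1$, the extended higher Herglotz function is $\mathfrak{F}_{k,N}(x):=\sum_{n=1}^\infty\frac{1}{n^k}\left(\psi\left(n^Nx\right)-\log\left(n^Nx\right)+\frac{1}{2n^Nx}\right)$, where $\psi=\Gamma'/\Gamma$ is the digamma function. $\gamma$ is Euler's constant and $\zeta$ the Riemann zeta function. The sum over $j$ in the main formula runs over $j=-(N-1),-(N-3),\dots,N-3,N-1$ (step 2).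
   Formalization: In the finite sum over j of R_{N,k}(x), in all three cases, the printed ζ(k−N) x^{(k−1)/N+j} is corrected to ζ(k−Nj) x^{(1−k)/N+j}; as printed the identity fails, e.g. for N=2, k=4, x=2. *)

theory Defs
  imports "HOL-Complex_Analysis.Complex_Analysis" "HOL-Number_Theory.Cong"
begin

(* The Dirichlet series is the Riemann zeta function only for Re s > 1.  Every zeta value and
   derivative used below is taken at a real point greater than 1. *)
definition zeta :: "complex \<Rightarrow> complex" where
  "zeta s = (\<Sum>n. 1 / of_nat (Suc n) powr s)"

(* Meaningful for k + 2 * N > 1 and x outside the half-line (-infinity, 0], where the series
   converges; powers and logarithms take their principal values throughout. *)
definition herglotz :: "real \<Rightarrow> real \<Rightarrow> complex \<Rightarrow> complex" where
  "herglotz k N x =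
    (\<Sum>n. 1 / of_real (real (Suc n) powr k) *
         (Digamma (of_real (real (Suc n) powr N) * x)
          - ln (of_real (real (Suc n) powr N) * x)
          + 1 / (2 * of_real (real (Suc n) powr N) * x)))"

(* The summand over j is N * (-1)^j * zeta(1 + j) * zeta(k - N * j) * x^((1 - k)/N + j), the residue
   contribution at s = -j of -pi * zeta(1 - s) * zeta(k + N * s) / (sin (pi * s) * x^s).  The formula
   in print has zeta(k - N) and x^((k - 1)/N + j) there; with these the identity fails as soon as the
   sum is non-empty (e.g. N = 2, k = 4).  The indices j satisfy k - N * j > 1. *)
definition herglotz_residue :: "nat \<Rightarrow> nat \<Rightarrow> complex \<Rightarrow> complex" where
  "herglotz_residue N k x =
    (if N dvd k - 1 then
       of_nat N / 2 * x powr ((1 - of_nat k - of_nat N) / of_nat N) * zeta (of_nat k + of_nat N)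
       + (-1) ^ ((k - 1) div N) *
           ((of_nat N * euler_mascheroni - ln x) * zeta ((of_nat N + of_nat k - 1) / of_nat N)
            - deriv zeta ((of_nat N + of_nat k - 1) / of_nat N))
       - of_nat N * x powr ((1 - of_nat k) / of_nat N) *
           (of_nat N * deriv zeta (of_nat k) - (euler_mascheroni + ln x) * zeta (of_nat k))
       + of_nat N * (\<Sum>j = 1..(k - 1) div N - 1.
           (-1) ^ j * zeta (1 + of_nat j) * zeta (of_nat k - of_nat N * of_nat j) *
           x powr ((1 - of_nat k) / of_nat N + of_nat j))
     else if N dvd k then
       of_nat N / 2 * x powr ((1 - of_nat k - of_nat N) / of_nat N) * zeta (of_nat k + of_nat N)
       - of_real pi * zeta ((of_nat N + of_nat k - 1) / of_nat N)
           / sin (of_real pi / of_nat N * (of_nat k - 1))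
       - of_nat N * x powr ((1 - of_nat k) / of_nat N) *
           (of_nat N * deriv zeta (of_nat k) - (euler_mascheroni + ln x) * zeta (of_nat k))
       - of_nat N / 2 * (-1) ^ (k div N) * x powr (1 / of_nat N)
           * zeta ((of_nat k + of_nat N) / of_nat N)
       + of_nat N * (\<Sum>j = 1..(k - 1) div N.
           (-1) ^ j * zeta (1 + of_nat j) * zeta (of_nat k - of_nat N * of_nat j) *
           x powr ((1 - of_nat k) / of_nat N + of_nat j))
     else
       of_nat N / 2 * x powr ((1 - of_nat k - of_nat N) / of_nat N) * zeta (of_nat k + of_nat N)
       - of_real pi * zeta ((of_nat N + of_nat k - 1) / of_nat N)
           / sin (of_real pi / of_nat N * (of_nat k - 1))
       - of_nat N * x powr ((1 - of_nat k) / of_nat N) *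
           (of_nat N * deriv zeta (of_nat k) - (euler_mascheroni + ln x) * zeta (of_nat k))
       + of_nat N * (\<Sum>j = 1..(k - 1) div N.
           (-1) ^ j * zeta (1 + of_nat j) * zeta (of_nat k - of_nat N * of_nat j) *
           x powr ((1 - of_nat k) / of_nat N + of_nat j)))"

end

theory Submission
  imports Defs
begin

text \<open>
  Expanding \<open>\<psi>\<close> by \<open>\<psi>(z) + 1/z + \<gamma> = \<Sum>m\<ge>1. 1/m - 1/(m + z)\<close> turns every extended Herglotz function, up to
  explicit zeta values, into an absolutely convergent double series. With \<open>v = x m^N / n\<close> and
  \<open>k - 1 = q N + r\<close>, the \<open>(m, n)\<close> term on the left is \<open>m^-k n^-1 v / (1 + v)\<close>. On the right, partial
  fractions over the \<open>N\<close>-th roots of \<open>- n / x\<close> give \<open>m^-k n^-1 (-v)^q (v / (1 + v) - \<delta>)\<close>, where \<open>\<delta>\<close> is \<open>1\<close> if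
  \<open>r = 0\<close> and \<open>0\<close> otherwise. The two differ by a finite geometric sum in \<open>-v\<close>, whose terms are products
  of a power of \<open>m\<close> and a power of \<open>n\<close>, and Fubini gives the products of zeta values in the residue.
  What remains are the sums over \<open>j\<close> of the weights \<open>exp (i \<pi> j (k - 1) / N)\<close> against \<open>1\<close>, \<open>j\<close> and
  \<open>exp (i \<pi> j / N)\<close>; their values account for the three cases.
\<close>

section \<open>The Dirichlet series of zeta and its derivative\<close>

lemma summable_Suc_powr:
  fixes p :: real
  assumes "p > 1"
  shows "summable (\<lambda>n. 1 / real (Suc n) powr p)"
proof -
  have "summable (\<lambda>n. real n powr - p)"
    using assms by (simp add: summable_real_powr_iff)
  then have "summable (\<lambda>n. real (Suc n) powr - p)"
    by (subst summable_Suc_iff)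
  then show ?thesis by (simp add: powr_minus divide_inverse)
qed

lemma Suc_powr_of_real:
  "(of_nat (Suc n) :: complex) powr of_real p = of_real (real (Suc n) powr p)"
  using powr_of_real[of "real (Suc n)" p] by simp

text \<open>Termwise differentiation on the half-plane Re s > 1: near each point the Dirichlet
  series has a convergent majorant, so its sum is differentiable with the termwise derivative. Both
  series are then read off at the real point \<open>p\<close>.\<close>

lemma
  fixes p :: real
  assumes "p > 1"
  shows zeta_sums: "(\<lambda>n. of_real (1 / real (Suc n) powr p)) sums zeta (of_real p)"
    and deriv_zeta_sums:
      "(\<lambda>n. of_real (ln (real (Suc n)) / real (Suc n) powr p)) sums - deriv zeta (of_real p)"
proof -
  let ?S = "{s. Re s > 1}"
  let ?f = "\<lambda>n s. 1 / (of_nat (Suc n) :: complex) powr s"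
  let ?f' = "\<lambda>n s. - of_real (ln (real (Suc n))) / (of_nat (Suc n) :: complex) powr s"
  have "\<exists>g g'. \<forall>s\<in>?S. (\<lambda>n. ?f n s) sums g s \<and> (\<lambda>n. ?f' n s) sums g' s \<and>
          (g has_field_derivative g' s) (at s)"
  proof (rule series_and_derivative_comparison_local)
    show "open ?S" by (rule open_halfspace_Re_gt)
  next
    fix n s
    have ln_Suc: "Ln (of_nat (Suc n)) = of_real (ln (real (Suc n)))"
      by (rule Ln_of_nat) simp
    show "(?f n has_field_derivative ?f' n s) (at s)"
      by (rule derivative_eq_intros refl | simp add: ln_Suc del: of_nat_Suc)+
  next
    fix s :: complex assume s: "s \<in> ?S"
    \<comment> \<open>Half the distance from \<open>s\<close> to the line Re = 1: the ball of radius
      \<open>d\<close> stays in Re t \<ge> 1 + d, so one majorant serves the whole ball.\<close>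
    define d where "d = (Re s - 1) / 2"
    have "norm (?f n t) \<le> 1 / real (Suc n) powr (1 + d)" if "t \<in> ball s d" for n t
    proof -
      have "Re s - Re t < d"
        using that complex_Re_le_cmod[of "s - t"] by (simp add: dist_norm)
      then have "Re t \<ge> 1 + d" by (simp add: d_def field_simps)
      moreover have "norm (?f n t) = 1 / real (Suc n) powr Re t"
        by (simp add: norm_divide norm_powr_real_powr del: of_nat_Suc)
      moreover have "real (Suc n) powr (1 + d) \<le> real (Suc n) powr Re t"
        using calculation(1) by (intro powr_mono) auto
      ultimately show ?thesis by (simp add: frac_le del: of_nat_Suc)
    qed
    moreover have "d > 0" using s by (simp add: d_def)
    ultimately show "\<exists>d h. 0 < d \<and> summable h \<and>
        (\<forall>\<^sub>F n in sequentially. \<forall>t\<in>ball s d \<inter> ?S. norm (?f n t) \<le> h n)"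
      by (intro exI[of _ d] exI[of _ "\<lambda>n. 1 / real (Suc n) powr (1 + d)"])
         (auto intro!: summable_Suc_powr simp del: of_nat_Suc)
  qed
  then obtain g g' where g: "\<And>s. Re s > 1 \<Longrightarrow> (\<lambda>n. ?f n s) sums g s"
      "\<And>s. Re s > 1 \<Longrightarrow> (\<lambda>n. ?f' n s) sums g' s"
      "\<And>s. Re s > 1 \<Longrightarrow> (g has_field_derivative g' s) (at s)" by fast
  have zeta_g: "g s = zeta s" if "Re s > 1" for s
    using sums_unique[OF g(1)[OF that]] by (simp add: zeta_def)
  show "(\<lambda>n. of_real (1 / real (Suc n) powr p)) sums zeta (of_real p)"
    using g(1)[of "of_real p"] assms zeta_g[of "of_real p"]
    by (simp add: Suc_powr_of_real del: of_nat_Suc)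
  \<comment> \<open>\<open>g\<close> is known to agree with \<open>zeta\<close> on the half-plane;
    since that set is open, the derivative carries over.\<close>
  have "(zeta has_field_derivative g' (of_real p)) (at (of_real p))"
    using assms zeta_g
    by (intro has_field_derivative_transform_within_open[OF g(3) open_halfspace_Re_gt[of 1]]) auto
  then have "deriv zeta (of_real p) = g' (of_real p)" by (rule DERIV_imp_deriv)
  then show "(\<lambda>n. of_real (ln (real (Suc n)) / real (Suc n) powr p)) sums - deriv zeta (of_real p)"
    using sums_minus[OF g(2)[of "of_real p"]] assms
    by (simp add: Suc_powr_of_real del: of_nat_Suc)
qed

section \<open>Reduction to a double series\<close>

lemma abs_summable_on_product:
  fixes f :: "'a \<Rightarrow> 'c :: {real_normed_field, banach}"
  assumes "(\<lambda>x. norm (f x)) summable_on A" "(\<lambda>y. norm (g y)) summable_on B"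
  shows "(\<lambda>(x, y). norm (f x * g y)) summable_on A \<times> B"
proof -
  have "(\<lambda>y. norm (f x) * norm (g y)) summable_on B" for x
    using assms(2) by (rule summable_on_cmult_right)
  moreover have "(\<lambda>x. norm (f x) * norm (\<Sum>\<^sub>\<infinity>y\<in>B. norm (g y))) summable_on A"
    using assms(1) by (rule summable_on_cmult_left)
  ultimately show ?thesis
    using Infinite_Sum.abs_summable_on_Sigma_iff[of "\<lambda>(x, y). f x * g y" A "\<lambda>_. B"]
    by (simp add: norm_mult infsum_cmult_right' abs_mult case_prod_unfold)
qed

text \<open>Let \<kappa> be the cosine of the argument of \<open>u\<close> and r = t |u|. The
  squared norm equals (1 + \<kappa>)/2 (s + r)^2 + (1 - \<kappa>)/2 (s - r)^2, and \<kappa> > -1 off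
  the cut. This bounds the denominators of the double series from below uniformly in both
  indices.\<close>

lemma sector_norm_bound:
  fixes u :: complex
  assumes "u \<notin> \<real>\<^sub>\<le>\<^sub>0"
  obtains c where "c > 0"
    "\<And>s t. s \<ge> 0 \<Longrightarrow> t \<ge> 0 \<Longrightarrow> c * (s + t * norm u) \<le> norm (of_real s + of_real t * u)"
proof -
  have u: "norm u > 0" using assms by auto
  have Re_gt: "Re u > - norm u"
  proof (rule ccontr)
    assume "\<not> Re u > - norm u"
    then have "norm u \<le> - Re u" by simp
    then have "(norm u)\<^sup>2 \<le> (- Re u)\<^sup>2" by (intro power_mono) auto
    then have "Im u = 0" by (simp add: cmod_power2)
    moreover have "Re u \<le> 0" using \<open>norm u \<le> - Re u\<close> norm_ge_zero[of u] by linarith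
    ultimately show False using assms by (simp add: complex_nonpos_Reals_iff)
  qed
  define \<kappa> where "\<kappa> = Re u / norm u"
  have \<kappa>: "-1 < \<kappa>" "\<kappa> \<le> 1" and Re_u: "Re u = \<kappa> * norm u"
    using u Re_gt complex_Re_le_cmod[of u] by (auto simp: \<kappa>_def field_simps)
  show thesis
  proof
    show "sqrt ((1 + \<kappa>) / 2) > 0" using \<kappa> by simp
  next
    fix s t :: real assume st: "s \<ge> 0" "t \<ge> 0"
    define r where "r = t * norm u"
    have "(norm (of_real s + of_real t * u))\<^sup>2 = s\<^sup>2 + t\<^sup>2 * ((Re u)\<^sup>2 + (Im u)\<^sup>2) + 2 * s * t * Re u"
      unfolding cmod_power2 by (simp add: power2_eq_square algebra_simps)
    also have "\<dots> = s\<^sup>2 + r\<^sup>2 + 2 * s * r * \<kappa>"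
      unfolding cmod_power2[symmetric] by (simp add: r_def Re_u power_mult_distrib)
    also have "\<dots> = (1 + \<kappa>) / 2 * (s + r)\<^sup>2 + (1 - \<kappa>) / 2 * (s - r)\<^sup>2"
      by (simp add: power2_eq_square algebra_simps add_divide_distrib diff_divide_distrib)
    finally have "(1 + \<kappa>) / 2 * (s + r)\<^sup>2 \<le> (norm (of_real s + of_real t * u))\<^sup>2"
      using \<kappa> by simp
    then have "sqrt ((1 + \<kappa>) / 2 * (s + r)\<^sup>2) \<le> norm (of_real s + of_real t * u)"
      by (simp add: real_le_lsqrt)
    then show "sqrt ((1 + \<kappa>) / 2) * (s + t * norm u) \<le> norm (of_real s + of_real t * u)"
      using st by (simp add: real_sqrt_mult r_def del: times_divide_eq_left)
  qed
qed

text \<open>The \<open>m\<close>-th term of the series for \<psi>(z) + 1/z + \<gamma> at z = (n +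
  1)^b u, with the weight of the outer Herglotz sum. Keeping 1/(m + 1) inside the term makes the
  double series absolutely convergent.\<close>

definition digamma_summand :: "real \<Rightarrow> real \<Rightarrow> complex \<Rightarrow> nat \<Rightarrow> nat \<Rightarrow> complex" where
  "digamma_summand p b u n m = 1 / of_real (real (Suc n) powr p) *
     (1 / of_nat (Suc m) - 1 / (of_nat (Suc m) + of_real (real (Suc n) powr b) * u))"

text \<open>With r = n^b |u|, the difference of reciprocals has norm at most r / (c m (m + r)).
  Interpolating with a small exponent \<alpha> bounds this by a constant times n^(b \<alpha>) m^(-1
  - \<alpha>), so the majorant is a product of two convergent series.\<close>

lemma digamma_summand_summable:
  assumes "p > 1" "b > 0" "u \<notin> \<real>\<^sub>\<le>\<^sub>0"
  shows "(\<lambda>(n, m). norm (digamma_summand p b u n m)) summable_on UNIV \<times> UNIV"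
proof -
  obtain c where c: "c > 0"
    "\<And>s t. s \<ge> 0 \<Longrightarrow> t \<ge> 0 \<Longrightarrow> c * (s + t * norm u) \<le> norm (of_real s + of_real t * u)"
    using sector_norm_bound[OF assms(3)] by blast
  have u: "norm u > 0" using assms by auto
  \<comment> \<open>Small enough that b \<alpha> \<le> (p - 1)/2, which leaves the outer exponent p
    - b \<alpha> above 1; positive, so that the inner exponent 1 + \<alpha> exceeds 1 as
    well.\<close>
  define \<alpha> where "\<alpha> = min (1/2) ((p - 1) / (2 * b))"
  have \<alpha>: "\<alpha> > 0" "\<alpha> < 1" "p - b * \<alpha> > 1"
  proof -
    show "\<alpha> > 0" "\<alpha> < 1" using assms by (auto simp: \<alpha>_def)
    have "b * \<alpha> \<le> b * ((p - 1) / (2 * b))"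
      using assms by (intro mult_left_mono) (auto simp: \<alpha>_def)
    also have "\<dots> = (p - 1) / 2" using assms by simp
    finally show "p - b * \<alpha> > 1" using assms by (simp add: field_simps)
  qed
  define C where "C = norm u powr \<alpha> / c"
  let ?g = "\<lambda>n m. C * ((1 / real (Suc n) powr (p - b * \<alpha>)) * (1 / real (Suc m) powr (1 + \<alpha>)))"
  have bound: "norm (digamma_summand p b u n m) \<le> ?g n m" for n m
  proof -
    define M t where "M = real (Suc m)" and "t = real (Suc n) powr b"
    define r where "r = t * norm u"
    have pos: "M > 0" "t > 0" "r > 0" using u by (auto simp: M_def t_def r_def)
    have low: "c * (M + r) \<le> norm (of_real M + of_real t * u)"
      unfolding r_def using pos by (intro c) auto
    have "0 < c * (M + r)" using c(1) pos by simp
    with low have nz: "of_real M + of_real t * u \<noteq> 0"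
      by (metis less_le_trans norm_zero less_irrefl)
    have "1 / of_real M - 1 / (of_real M + of_real t * u) =
        of_real t * u / (of_real M * (of_real M + of_real t * u))"
      using nz pos by (simp add: field_simps)
    then have "norm (1 / of_real M - 1 / (of_real M + of_real t * u)) =
        r / (M * norm (of_real M + of_real t * u))"
      using pos by (simp add: norm_mult norm_divide r_def)
    also have "\<dots> \<le> r / (M * (c * (M + r)))"
      using low pos c(1) \<open>0 < c * (M + r)\<close> nz
      by (intro divide_left_mono mult_left_mono mult_pos_pos) auto
    \<comment> \<open>Split r = r^\<alpha> r^(1 - \<alpha>), enlarge the second factor to (M + r)^(1
      - \<alpha>), and use (M + r)^(-\<alpha>) \<le> M^(-\<alpha>).\<close>
    also have "r \<le> r powr \<alpha> * M powr - \<alpha> * (M + r)"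
    proof -
      have "r = r powr \<alpha> * r powr (1 - \<alpha>)" using pos by (simp flip: powr_add)
      also have "\<dots> \<le> r powr \<alpha> * (M + r) powr (1 - \<alpha>)"
        using pos \<alpha> by (intro mult_left_mono powr_mono2) auto
      also have "(M + r) powr (1 - \<alpha>) = (M + r) powr - \<alpha> * (M + r)"
        using pos powr_add[of "M + r" "- \<alpha>" 1] by simp
      also have "(M + r) powr - \<alpha> \<le> M powr - \<alpha>"
        using pos \<alpha> by (intro powr_mono2') auto
      finally show ?thesis using pos by (simp add: mult_ac mult_left_mono)
    qed
    then have "r / (M * (c * (M + r))) \<le> r powr \<alpha> * M powr - \<alpha> * (M + r) / (M * (c * (M + r)))"
      using pos c(1) by (intro divide_right_mono) auto
    also have "\<dots> = C * t powr \<alpha> * (1 / M powr (1 + \<alpha>))"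
    proof -
      have "r powr \<alpha> * M powr - \<alpha> * (M + r) / (M * (c * (M + r))) = r powr \<alpha> * M powr - \<alpha> / (M * c)"
        using pos by simp
      also have "\<dots> = C * t powr \<alpha> * (1 / M powr (1 + \<alpha>))"
        using pos c(1) u by (simp add: C_def r_def powr_mult powr_add powr_minus field_simps)
      finally show ?thesis .
    qed
    finally have "norm (1 / of_real M - 1 / (of_real M + of_real t * u)) \<le>
        C * t powr \<alpha> * (1 / M powr (1 + \<alpha>))" .
    then have "1 / real (Suc n) powr p * norm (1 / of_real M - 1 / (of_real M + of_real t * u)) \<le>
        1 / real (Suc n) powr p * (C * t powr \<alpha> * (1 / M powr (1 + \<alpha>)))"
      by (intro mult_left_mono) auto
    also have "\<dots> = C * ((1 / real (Suc n) powr p * t powr \<alpha>) * (1 / M powr (1 + \<alpha>)))"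
      by (simp only: mult_ac)
    also have "1 / real (Suc n) powr p * t powr \<alpha> = 1 / real (Suc n) powr (p - b * \<alpha>)"
      by (simp add: t_def powr_powr powr_diff)
    also have "1 / real (Suc n) powr p * norm (1 / of_real M - 1 / (of_real M + of_real t * u)) =
        norm (digamma_summand p b u n m)"
      by (simp add: digamma_summand_def norm_mult norm_divide M_def t_def del: of_nat_Suc)
    finally show ?thesis unfolding M_def .
  qed
  have "(\<lambda>(n, m). ?g n m) summable_on UNIV \<times> UNIV"
  proof -
    have "(\<lambda>n. 1 / real (Suc n) powr (p - b * \<alpha>)) summable_on UNIV"
         "(\<lambda>n. 1 / real (Suc n) powr (1 + \<alpha>)) summable_on UNIV"
      using \<alpha> summable_Suc_powr by (subst summable_on_UNIV_nonneg_real_iff; simp)+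
    then have "(\<lambda>(n, m). (1 / real (Suc n) powr (p - b * \<alpha>)) * (1 / real (Suc m) powr (1 + \<alpha>)))
        summable_on UNIV \<times> UNIV"
      using abs_summable_on_product[of "\<lambda>n. 1 / real (Suc n) powr (p - b * \<alpha>)" UNIV
          "\<lambda>m. 1 / real (Suc m) powr (1 + \<alpha>)" UNIV]
      by (simp add: case_prod_unfold norm_mult)
    then show ?thesis by (auto dest: summable_on_cmult_right[of _ _ C] simp: case_prod_unfold)
  qed
  then show ?thesis
    using Infinite_Sum.abs_summable_on_comparison_test'[of "\<lambda>(n, m). ?g n m" "UNIV \<times> UNIV"
      "\<lambda>(n, m). digamma_summand p b u n m"] bound by (simp add: case_prod_unfold)
qed

section \<open>Recovering the Herglotz function from the row sums\<close>

lemma Digamma_sums: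
  fixes z :: complex
  assumes "z \<notin> \<real>\<^sub>\<le>\<^sub>0"
  shows "(\<lambda>m. 1 / of_nat (Suc m) - 1 / (of_nat (Suc m) + z)) sums (Digamma z + 1 / z + euler_mascheroni)"
proof -
  have "z + 1 \<noteq> 0"
    using assms by (auto simp: add_eq_0_iff2)
  then have "(\<lambda>m. inverse (of_nat (Suc m)) - inverse (z + 1 + of_nat m)) sums
      (Digamma (z + 1) + euler_mascheroni)"
    using summable_sums[OF summable_Digamma] by (simp add: Digamma_def)
  moreover have "Digamma (z + 1) = Digamma z + 1 / z"
    using assms by (intro Digamma_plus1) auto
  ultimately show ?thesis by (simp add: inverse_eq_divide add_ac)
qed

text \<open>Summing over \<open>m\<close> first turns row \<open>n\<close> into \<psi>(z) + 1/z +
  \<gamma> at z = (n + 1)^b u. Compared with the Herglotz term, the surplus consists of \<gamma>, of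
  ln z = b ln (n + 1) + ln u and of 1/(2z); weighted and summed over \<open>n\<close>, these give
  the values of \<open>zeta\<close> and its derivative.\<close>

lemma herglotz_expansion:
  assumes p: "p > 1" and b: "b > 0" and u: "u \<notin> \<real>\<^sub>\<le>\<^sub>0"
  shows "herglotz p b u =
    (\<Sum>\<^sub>\<infinity>(n, m)\<in>UNIV \<times> UNIV. digamma_summand p b u n m)
    + of_real b * deriv zeta (of_real p) - (euler_mascheroni + ln u) * zeta (of_real p)
    - zeta (of_real (p + b)) / (2 * u)"
proof -
  let ?D = "\<lambda>(n, m). digamma_summand p b u n m"
  let ?z = "\<lambda>n. of_real (real (Suc n) powr b) * u"
  let ?row = "\<lambda>n. 1 / of_real (real (Suc n) powr p) * (Digamma (?z n) + 1 / ?z n + euler_mascheroni)"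
  have u0: "u \<noteq> 0" using u by auto
  have summ: "?D summable_on UNIV \<times> UNIV"
    by (rule Infinite_Sum.abs_summable_summable)
      (use digamma_summand_summable[OF assms] in \<open>simp add: case_prod_unfold\<close>)
  have row: "((\<lambda>m. ?D (n, m)) has_sum ?row n) UNIV" for n
  proof -
    have "?z n \<notin> \<real>\<^sub>\<le>\<^sub>0"
      using u by (auto simp: complex_nonpos_Reals_iff mult_le_0_iff)
    then have "(\<lambda>m. ?D (n, m)) sums ?row n"
      unfolding digamma_summand_def prod.case by (intro sums_mult Digamma_sums)
    \<comment> \<open>The digamma series supplies the value only as an ordered sum; unconditional
      summability comes from the double series, and uniqueness of limits joins the two.\<close>
    moreover have "(\<lambda>m. ?D (n, m)) summable_on UNIV"
      using summable_on_SigmaD1[OF summ, of n] by simp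
    ultimately show ?thesis
      by (metis has_sum_imp_sums has_sum_infsum sums_unique2)
  qed
  have "(?row has_sum (\<Sum>\<^sub>\<infinity>(n, m)\<in>UNIV \<times> UNIV. digamma_summand p b u n m)) UNIV"
    by (rule has_sum_SigmaD[OF has_sum_infsum[OF summ] row])
  then have "?row sums (\<Sum>\<^sub>\<infinity>(n, m)\<in>UNIV \<times> UNIV. digamma_summand p b u n m)"
    by (rule has_sum_imp_sums)
  moreover have "(\<lambda>n. of_real b * of_real (ln (real (Suc n)) / real (Suc n) powr p)) sums
      (of_real b * - deriv zeta (of_real p))"
    by (intro sums_mult deriv_zeta_sums p)
  moreover have "(\<lambda>n. (euler_mascheroni + ln u) * of_real (1 / real (Suc n) powr p)) sums
      ((euler_mascheroni + ln u) * zeta (of_real p))"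
    by (intro sums_mult zeta_sums p)
  moreover have "(\<lambda>n. of_real (1 / real (Suc n) powr (p + b)) / (2 * u)) sums
      (zeta (of_real (p + b)) / (2 * u))"
    using p b by (intro sums_divide zeta_sums) auto
  ultimately have "(\<lambda>n. ?row n - of_real b * of_real (ln (real (Suc n)) / real (Suc n) powr p)
      - (euler_mascheroni + ln u) * of_real (1 / real (Suc n) powr p)
      - of_real (1 / real (Suc n) powr (p + b)) / (2 * u)) sums
      ((\<Sum>\<^sub>\<infinity>(n, m)\<in>UNIV \<times> UNIV. digamma_summand p b u n m)
        - of_real b * - deriv zeta (of_real p) - (euler_mascheroni + ln u) * zeta (of_real p)
        - zeta (of_real (p + b)) / (2 * u))"
    by (intro sums_diff)
  moreover have "?row n - of_real b * of_real (ln (real (Suc n)) / real (Suc n) powr p)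
      - (euler_mascheroni + ln u) * of_real (1 / real (Suc n) powr p)
      - of_real (1 / real (Suc n) powr (p + b)) / (2 * u) =
      1 / of_real (real (Suc n) powr p) * (Digamma (?z n) - ln (?z n)
          + 1 / (2 * of_real (real (Suc n) powr b) * u))" for n
  proof -
    have ln: "ln (?z n) = of_real b * of_real (ln (real (Suc n))) + ln u"
      using u0 by (subst Ln_times_of_real) (auto simp: Ln_of_real ln_powr)
    have alg: "1 / P * (D + 1 / (B * u) + g) - b' * (L / P) - (g + l) * (1 / P) - 1 / (P * B) / (2 * u) =
        1 / P * (D - (b' * L + l) + 1 / (2 * B * u))"
      if "P \<noteq> 0" "B \<noteq> 0" for P B D g b' L l :: complex
      using that u0 by (simp add: field_simps)
    show ?thesis
      unfolding ln powr_add of_real_mult of_real_divide of_real_1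
      by (rule alg) auto
  qed
  ultimately show ?thesis
    unfolding herglotz_def by (simp add: sums_iff)
qed

section \<open>Sums over roots of unity\<close>

lemma sum_parity_interval:
  fixes f :: "int \<Rightarrow> 'a :: comm_monoid_add"
  assumes "N > 0"
  shows "(\<Sum>j | j \<in> {- (int N - 1)..int N - 1} \<and> [j = int N - 1] (mod 2). f j) =
    (\<Sum>l<N. f (2 * int l - (int N - 1)))"
proof (rule sum.reindex_bij_witness[where i = "\<lambda>l. 2 * int l - (int N - 1)"
      and j = "\<lambda>j. nat ((j + (int N - 1)) div 2)"])
  fix j assume "j \<in> {j. j \<in> {- (int N - 1)..int N - 1} \<and> [j = int N - 1] (mod 2)}"
  then have j: "- (int N - 1) \<le> j" "j \<le> int N - 1" "[j = int N - 1] (mod 2)" by auto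
  then have "even (j - (int N - 1))" by (simp add: cong_iff_dvd_diff)
  then have "2 * ((j + (int N - 1)) div 2) = j + (int N - 1)" by presburger
  then show "2 * int (nat ((j + (int N - 1)) div 2)) - (int N - 1) = j"
    and "nat ((j + (int N - 1)) div 2) \<in> {..<N}"
    using j assms by auto
  then show "f (2 * int (nat ((j + (int N - 1)) div 2)) - (int N - 1)) = f j" by simp
next
  fix l assume l: "l \<in> {..<N}"
  show "nat ((2 * int l - (int N - 1) + (int N - 1)) div 2) = l" by simp
  have "2 * int l - (int N - 1) - (int N - 1) = 2 * (int l - (int N - 1))" by simp
  then have "[2 * int l - (int N - 1) = int N - 1] (mod 2)"
    unfolding cong_iff_dvd_diff by (metis dvd_triv_left)
  then show "2 * int l - (int N - 1) \<in> {j. j \<in> {- (int N - 1)..int N - 1} \<and> [j = int N - 1] (mod 2)}"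
    using l by auto
qed

text \<open>
  For the indices \<open>j \<equiv> N - 1 (mod 2)\<close> of the theorem, \<open>- exp (i \<pi> j / N)\<close> runs through the \<open>N\<close>-th
  roots of \<open>-1\<close>; \<open>root_sum\<close> enumerates them as \<open>j = 2 l - (N - 1)\<close> with \<open>l < N\<close>.
\<close>

definition root_sum :: "nat \<Rightarrow> (int \<Rightarrow> complex) \<Rightarrow> complex" where
  "root_sum N f = (\<Sum>l<N. f (2 * int l - (int N - 1)))"

definition unit_root :: "nat \<Rightarrow> int \<Rightarrow> complex" where
  "unit_root N h = exp (\<i> * of_real pi * of_int h / of_nat N)"

section \<open>Arithmetic and orthogonality of the unit roots\<close>

lemma unit_root_add: "unit_root N (g + h) = unit_root N g * unit_root N h"
  by (simp add: unit_root_def ring_distribs add_divide_distrib exp_add)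

lemma unit_root_power: "unit_root N h ^ n = unit_root N (int n * h)"
  by (simp add: unit_root_def exp_of_nat_mult[symmetric] mult_ac)

lemma unit_root_nonzero: "unit_root N h \<noteq> 0"
  by (simp add: unit_root_def)

lemma unit_root_minus: "unit_root N (- h) = 1 / unit_root N h"
  by (simp add: unit_root_def exp_minus divide_inverse)

lemma unit_root_mult_self:
  assumes "N > 0"
  shows "unit_root N (int N * h) = (if even h then 1 else -1)"
proof -
  have "unit_root N (int N * h) = exp (\<i> * of_real pi * of_int h)"
    using assms by (simp add: unit_root_def mult.assoc)
  also have "\<dots> = (if even h then 1 else -1)"
  proof (cases "even h")
    case True
    then obtain c where "h = 2 * c" by blast
    then show ?thesis
      using exp_integer_2pi[of "of_int c"] by (simp add: mult_ac)
  next
    case False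
    then obtain c where "h = 2 * c + 1" by (rule oddE)
    then show ?thesis
      using exp_integer_2pi_plus1[of "of_int c"] False by (simp add: algebra_simps)
  qed
  finally show ?thesis .
qed

lemma unit_root_double_eq_1_iff:
  assumes "N > 0"
  shows "unit_root N (2 * h) = 1 \<longleftrightarrow> int N dvd h"
proof
  assume "int N dvd h"
  then obtain c where "h = int N * c" by blast
  then have "unit_root N (2 * h) = unit_root N (int N * (2 * c))" by (simp add: mult_ac)
  then show "unit_root N (2 * h) = 1" using unit_root_mult_self[OF assms, of "2 * c"] by simp
next
  assume "unit_root N (2 * h) = 1"
  then obtain n :: int where "2 * of_int h * pi / real N = of_int (2 * n) * pi"
    by (auto simp: unit_root_def exp_eq_1 mult_ac)
  then have "real_of_int h = real_of_int (int N * n)" using assms by (simp add: field_simps)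
  then show "int N dvd h" by (metis dvd_triv_left of_int_eq_iff)
qed

text \<open>Along j = 2 l - (N - 1) the terms form a geometric progression with ratio q = exp (2
  \<pi> i h / N). As q^N = 1, the sum vanishes unless q = 1, and then all terms are equal.\<close>

lemma root_sum_unit_root:
  assumes "N > 0"
  shows "root_sum N (\<lambda>j. unit_root N (h * j)) =
    (if int N dvd h then of_nat N * unit_root N (h * (int N - 1)) else 0)"
proof -
  define q where "q = unit_root N (2 * h)"
  have *: "unit_root N (h * (2 * int l - (int N - 1))) = unit_root N (- (h * (int N - 1))) * q ^ l" for l
    unfolding q_def unit_root_power unit_root_add[symmetric] by (simp add: algebra_simps)
  have sum: "root_sum N (\<lambda>j. unit_root N (h * j)) = unit_root N (- (h * (int N - 1))) * (\<Sum>l<N. q ^ l)"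
    unfolding root_sum_def * by (simp add: sum_distrib_left)
  have qN: "q ^ N = 1"
    using unit_root_mult_self[OF assms, of "2 * h"] by (simp add: q_def unit_root_power)
  show ?thesis
  proof (cases "int N dvd h")
    case True
    then have "q = 1" using assms by (simp add: q_def unit_root_double_eq_1_iff)
    moreover have "unit_root N (2 * (h * (int N - 1))) = 1"
      using True assms by (simp add: unit_root_double_eq_1_iff)
    then have "unit_root N (- (h * (int N - 1))) = unit_root N (h * (int N - 1))"
      using unit_root_add[of N "2 * (h * (int N - 1))" "- (h * (int N - 1))"] by simp
    ultimately show ?thesis using True sum by simp
  next
    case False
    then have "q \<noteq> 1" using assms by (simp add: q_def unit_root_double_eq_1_iff)
    then have "(\<Sum>l<N. q ^ l) = 0" using qN by (simp add: sum_gp_strict)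
    then show ?thesis using False sum by simp
  qed
qed

text \<open>Summation by parts. For q^n = 1 and q \<noteq> 1 in a field it gives n / (q - 1) for the
  weighted sum.\<close>

lemma sum_index_times_power:
  fixes q :: "'a :: comm_ring_1"
  shows "(q - 1) * (\<Sum>l<n. of_nat l * q ^ l) = of_nat n * q ^ n - q * (\<Sum>l<n. q ^ l)"
  by (induction n) (simp_all add: algebra_simps)

text \<open>This is the source of the sine in the residue. The constant part of the index drops out
  because the powers of \<open>q\<close> sum to 0, and the rest gives 2 N c / (q - 1), where c =
  (-1)^h w and w^2 = q. Dividing q - 1 by 2 i w turns it into the sine of \<pi> h / N.\<close>

lemma root_sum_index_times_unit_root:
  assumes N: "N > 0" and h: "\<not> int N dvd h"
  shows "root_sum N (\<lambda>j. of_int j * unit_root N (h * j)) =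
    - \<i> * of_nat N * (if even h then 1 else -1) / sin (of_real pi / of_nat N * of_int h)"
proof -
  define e :: complex where "e = (if even h then 1 else -1)"
  define w where "w = unit_root N h"
  define q where "q = unit_root N (2 * h)"
  have q: "q \<noteq> 1" "q ^ N = 1"
    using unit_root_mult_self[OF N, of "2 * h"] h N
    by (auto simp: q_def unit_root_power unit_root_double_eq_1_iff)
  have w: "w \<noteq> 0" "q = w * w"
    by (simp_all add: w_def q_def unit_root_nonzero flip: unit_root_add)
  let ?c = "unit_root N (- (h * (int N - 1)))"
  have *: "unit_root N (h * (2 * int l - (int N - 1))) = ?c * q ^ l" for l
    unfolding q_def unit_root_power unit_root_add[symmetric] by (simp add: algebra_simps)
  have "(\<Sum>l<N. q ^ l) = 0" using q by (simp add: sum_gp_strict)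
  moreover have "(\<Sum>l<N. of_nat l * q ^ l) = of_nat N / (q - 1)"
    using q sum_index_times_power[of q N] \<open>(\<Sum>l<N. q ^ l) = 0\<close> by (simp add: field_simps)
  moreover have "root_sum N (\<lambda>j. of_int j * unit_root N (h * j)) =
      2 * ?c * (\<Sum>l<N. of_nat l * q ^ l) - (of_nat N - 1) * ?c * (\<Sum>l<N. q ^ l)"
    unfolding root_sum_def * sum_distrib_left sum_subtractf[symmetric]
    by (intro sum.cong refl) (simp add: algebra_simps)
  ultimately have "root_sum N (\<lambda>j. of_int j * unit_root N (h * j)) = 2 * of_nat N * ?c / (q - 1)"
    by simp
  also have "?c = e * w"
  proof -
    have "?c = unit_root N (int N * - h) * w"
      unfolding w_def unit_root_add[symmetric] by (simp add: algebra_simps)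
    then show ?thesis using unit_root_mult_self[OF N, of "- h"] by (simp add: e_def)
  qed
  also have "2 * of_nat N * (e * w) / (q - 1) = - \<i> * of_nat N * e / ((q - 1) / (2 * \<i> * w))"
    using w by (simp add: mult_ac)
  also have "(q - 1) / (2 * \<i> * w) = (q - 1) / w / (2 * \<i>)"
    by (simp only: divide_divide_eq_left mult_ac)
  also have "(q - 1) / w = w - 1 / w"
    using w by (simp add: diff_divide_distrib)
  also have "(w - 1 / w) / (2 * \<i>) = sin (of_real pi / of_nat N * of_int h)"
  proof -
    have "w = exp (\<i> * (of_real pi / of_nat N * of_int h))" by (simp add: w_def unit_root_def mult.assoc)
    then show ?thesis by (simp add: sin_exp_eq exp_minus inverse_eq_divide)
  qed
  finally show ?thesis unfolding e_def .
qed

lemma unit_root_mult_self_nat: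
  "N > 0 \<Longrightarrow> unit_root N (int N * int c) = (-1) ^ c"
  by (simp add: unit_root_mult_self)

lemma root_sum_unit_root_nat:
  assumes "N > 0"
  shows "root_sum N (\<lambda>j. unit_root N (int h * j)) =
    (if N dvd h then of_nat N * (-1) ^ (h div N * (N - 1)) else 0)"
proof (cases "N dvd h")
  case True
  then obtain c where c: "h = N * c" by blast
  have "unit_root N (int h * (int N - 1)) = unit_root N (int N * int (c * (N - 1)))"
    using assms by (simp add: c of_nat_diff mult_ac)
  then have "unit_root N (int h * (int N - 1)) = (-1) ^ (c * (N - 1))"
    using unit_root_mult_self_nat[OF assms, of "c * (N - 1)"] by argo
  then show ?thesis using True assms root_sum_unit_root[OF assms, of "int h"] by (simp add: c)
next
  case False
  then show ?thesis using root_sum_unit_root[OF assms, of "int h"] by simp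
qed

section \<open>Partial fractions over the roots of a binomial\<close>

lemma root_sum_cong:
  assumes "\<And>j. \<lbrakk>- (int N - 1) \<le> j; j \<le> int N - 1; even (j - (int N - 1))\<rbrakk> \<Longrightarrow> f j = g j"
  shows "root_sum N f = root_sum N g"
  unfolding root_sum_def by (intro sum.cong refl assms) auto

lemma root_sum_distrib:
  "c * root_sum N f = root_sum N (\<lambda>j. c * f j)"
  "root_sum N f + root_sum N g = root_sum N (\<lambda>j. f j + g j)"
  "root_sum N f - root_sum N g = root_sum N (\<lambda>j. f j - g j)"
  by (simp_all add: root_sum_def sum_distrib_left sum.distrib sum_subtractf)

text \<open>The numbers z = -Y exp (-i \<pi> j / N) satisfy z^N = -Y^N, so 1 / (M - z) is the sum of
  M^(N - 1 - i) z^i over i < N, divided by M^N + Y^N. Summing over \<open>j\<close> against the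
  weight keeps only the power i = r, by orthogonality.\<close>

lemma root_sum_partial_fractions:
  fixes M Y :: complex
  assumes r: "r < N" and nz: "M ^ N + Y ^ N \<noteq> 0"
  shows "root_sum N (\<lambda>j. unit_root N (int (q * N + r) * j) / (M + Y * unit_root N (- j))) =
    of_nat N * (-1) ^ (q * (N - 1) + r) * M ^ (N - 1 - r) * Y ^ r / (M ^ N + Y ^ N)"
proof -
  have N: "N > 0" using r by simp
  define h where "h = int (q * N + r)"
  have "root_sum N (\<lambda>j. unit_root N (h * j) / (M + Y * unit_root N (- j))) =
      root_sum N (\<lambda>j. \<Sum>i<N. M ^ (N - 1 - i) * (- Y) ^ i / (M ^ N + Y ^ N) * unit_root N ((h - int i) * j))"
  proof (rule root_sum_cong)
    fix j assume "even (j - (int N - 1))"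
    define z where "z = - (Y * unit_root N (- j))"
    \<comment> \<open>Here the parity of the indices enters: \<open>j\<close> and \<open>N\<close>
      have opposite parity, so (-1)^N (-1)^j = -1.\<close>
    have "(- 1) ^ N * unit_root N (int N * - j) = -1"
      using \<open>even (j - (int N - 1))\<close> unit_root_mult_self[OF N, of "- j"] by (cases "even N") auto
    then have zN: "z ^ N = - (Y ^ N)"
      unfolding z_def unit_root_power power_minus[of "Y * _"] power_mult_distrib
      by (simp add: algebra_simps)
    have fac: "M ^ N + Y ^ N = (M - z) * (\<Sum>i<N. M ^ (N - Suc i) * z ^ i)"
      using power_diff_sumr2[of z N M] zN by (simp add: algebra_simps)
    have "M - z \<noteq> 0" using nz fac by auto
    then have "1 / (M - z) = (\<Sum>i<N. M ^ (N - Suc i) * z ^ i) / (M ^ N + Y ^ N)"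
      unfolding fac using nz fac by (simp add: divide_simps)
    then have "unit_root N (h * j) / (M + Y * unit_root N (- j)) =
        unit_root N (h * j) * ((\<Sum>i<N. M ^ (N - Suc i) * z ^ i) / (M ^ N + Y ^ N))"
      by (simp add: z_def divide_inverse)
    also have "\<dots> = (\<Sum>i<N. M ^ (N - Suc i) * (unit_root N (h * j) * z ^ i) / (M ^ N + Y ^ N))"
      by (simp add: sum_distrib_left sum_divide_distrib mult_ac)
    also have "\<dots> = (\<Sum>i<N. M ^ (N - 1 - i) * (- Y) ^ i / (M ^ N + Y ^ N) * unit_root N ((h - int i) * j))"
    proof (intro sum.cong refl)
      fix i
      have "z ^ i = (- Y) ^ i * unit_root N (int i * - j)"
        unfolding z_def mult_minus_left[symmetric] power_mult_distrib unit_root_power ..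
      then have "unit_root N (h * j) * z ^ i = (- Y) ^ i * unit_root N ((h - int i) * j)"
        using unit_root_add[of N "h * j" "int i * - j"] by (simp add: algebra_simps)
      then show "M ^ (N - Suc i) * (unit_root N (h * j) * z ^ i) / (M ^ N + Y ^ N) =
          M ^ (N - 1 - i) * (- Y) ^ i / (M ^ N + Y ^ N) * unit_root N ((h - int i) * j)"
        by simp
    qed
    finally show "unit_root N (h * j) / (M + Y * unit_root N (- j)) =
      (\<Sum>i<N. M ^ (N - 1 - i) * (- Y) ^ i / (M ^ N + Y ^ N) * unit_root N ((h - int i) * j))" .
  qed
  also have "\<dots> = (\<Sum>i<N. M ^ (N - 1 - i) * (- Y) ^ i / (M ^ N + Y ^ N)
      * root_sum N (\<lambda>j. unit_root N ((h - int i) * j)))"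
    unfolding root_sum_def sum_distrib_left by (rule sum.swap)
  also have "\<dots> = (\<Sum>i<N. if i = r then M ^ (N - 1 - r) * (- Y) ^ r / (M ^ N + Y ^ N)
      * (of_nat N * (-1) ^ (q * (N - 1))) else 0)"
  proof (intro sum.cong refl)
    fix i assume i: "i \<in> {..<N}"
    show "M ^ (N - 1 - i) * (- Y) ^ i / (M ^ N + Y ^ N) * root_sum N (\<lambda>j. unit_root N ((h - int i) * j)) =
      (if i = r then M ^ (N - 1 - r) * (- Y) ^ r / (M ^ N + Y ^ N)
      * (of_nat N * (-1) ^ (q * (N - 1))) else 0)"
    proof (cases "i = r")
      case True
      then have "h - int i = int (q * N)" by (simp add: h_def)
      then show ?thesis using True root_sum_unit_root_nat[OF N, of "q * N"] N by simp
    next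
      case False
      have "\<not> int N dvd h - int i"
      proof
        assume "int N dvd h - int i"
        then have "int N dvd int r - int i"
          unfolding h_def using dvd_add_right_iff[of "int N" "int (q * N)" "int r - int i"] by (simp add: algebra_simps)
        moreover have "\<bar>int r - int i\<bar> < int N" using i r by auto
        ultimately show False using False zdvd_imp_le[of "int N" "\<bar>int r - int i\<bar>"] by auto
      qed
      then show ?thesis using False root_sum_unit_root[OF N, of "h - int i"] by simp
    qed
  qed
  also have "\<dots> = M ^ (N - 1 - r) * (- Y) ^ r / (M ^ N + Y ^ N) * (of_nat N * (-1) ^ (q * (N - 1)))"
    using r by simp
  also have "(- Y) ^ r = (-1) ^ r * Y ^ r" by (rule power_minus)
  finally show ?thesis by (simp add: h_def power_add mult_ac)
qed

section \<open>Termwise comparison\<close>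

lemma geometric_expansion:
  fixes v :: "'a :: field"
  assumes "1 + v \<noteq> 0"
  shows "(\<Sum>i=1..n. (- v) ^ i) = (- v - (- v) ^ Suc n) / (1 + v)"
proof (induction n)
  case (Suc n)
  then show ?case using assms by (simp add: field_simps)
qed simp

text \<open>The indices are transposed: \<open>m\<close> is the outer index on the left and the
  digamma index on the right. For r = 0 the geometric sum stops at \<open>q - 1\<close>, since i = q
  would leave the exponent k - N q = 1, which is not summable.\<close>

lemma digamma_summand_decomposition:
  fixes x :: complex
  assumes r: "r < N" and k: "k = q * N + r + 1" "k > 1" and x: "Re x > 0"
  defines "Q \<equiv> if r = 0 then q - 1 else q"
  defines "X \<equiv> x powr (1 / of_nat N)"
  shows "digamma_summand (real k) (real N) x m n =
    (-1) ^ k / of_nat N * X ^ (k - 1) *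
      root_sum N (\<lambda>j. unit_root N (int (k - 1) * j) *
        digamma_summand ((real N + real k - 1) / real N) (1 / real N) (unit_root N (- j) / X) n m)
    - (\<Sum>i=1..Q. (- x) ^ i * (1 / of_nat (Suc n) ^ (1 + i)) * (1 / of_nat (Suc m) ^ (k - N * i)))"
proof -
  have N: "N > 0" using r by simp
  have x0: "x \<noteq> 0" using x by auto
  define M L s :: complex where "M = of_nat (Suc m)" and "L = of_nat (Suc n)"
    and "s = of_real (real (Suc n) powr (1 / real N))"
  \<comment> \<open>\<open>Y\<close> is chosen with Y^N = L / x, so that v = (M / Y)^N and M^N + Y^N
    is a multiple of 1 + v. The sign \<sigma> comes from the root sums, and \<delta> records whether
    \<open>N\<close> divides \<open>k - 1\<close>.\<close>
  define Y v where "Y = s / X" and "v = x * M ^ N / L"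
  define \<delta> \<sigma> :: complex where "\<delta> = (if r = 0 then 1 else 0)" and "\<sigma> = (-1) ^ (q * (N - 1))"
  have nz: "M \<noteq> 0" "L \<noteq> 0" "s \<noteq> 0" "X \<noteq> 0" "Y \<noteq> 0"
    using x0 by (auto simp: M_def L_def s_def X_def Y_def simp del: of_nat_Suc)
  have XN: "X ^ N = x"
    using x0 N by (simp add: X_def powr_def flip: exp_of_nat_mult)
  have sN: "s ^ N = L"
  proof -
    have "s ^ N = of_real ((real (Suc n) powr (1 / real N)) ^ N)" by (simp add: s_def)
    also have "(real (Suc n) powr (1 / real N)) ^ N = real (Suc n)"
      using N by (simp add: powr_power del: of_nat_Suc)
    finally show ?thesis by (simp add: L_def)
  qed
  have YN: "Y ^ N = L / x" by (simp add: Y_def power_divide XN sN)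
  have "Re (M ^ N * x) > 0"
  proof -
    have "M ^ N * x = of_real (real (Suc m) ^ N) * x" by (simp add: M_def)
    then show ?thesis using x by (simp only: Re_complex_of_real times_complex.simps) simp
  qed
  then have "Re (L + M ^ N * x) > 0" by (simp add: L_def)
  then have sum_nz: "L + M ^ N * x \<noteq> 0" by (metis less_irrefl zero_complex.simps(1))
  then have v: "1 + v \<noteq> 0" "v \<noteq> 0"
    using nz x0 by (auto simp: v_def add_divide_eq_if_simps mult_ac)
  have MY: "M ^ N + Y ^ N = M ^ N * (1 + v) / v" and MY0: "M ^ N + Y ^ N \<noteq> 0"
  proof -
    show "M ^ N + Y ^ N = M ^ N * (1 + v) / v"
      using nz x0 by (simp add: YN v_def field_simps)
    then show "M ^ N + Y ^ N \<noteq> 0" using nz v by simp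
  qed
  have L_powr: "of_real (real (Suc n) powr ((real N + real k - 1) / real N)) = L * s ^ (k - 1)"
  proof -
    have "(real N + real k - 1) / real N = 1 + (1 / real N) * real (k - 1)"
      using N k by (simp add: field_simps of_nat_diff)
    then have "real (Suc n) powr ((real N + real k - 1) / real N) =
        real (Suc n) * (real (Suc n) powr (1 / real N)) ^ (k - 1)"
      by (simp add: powr_add powr_power mult_ac del: of_nat_Suc)
    then show ?thesis by (simp add: L_def s_def)
  qed
  \<comment> \<open>The exponents of -1, together with \<open>q\<close>, add up to the odd number 2
    (q N + r) + 1.\<close>
  have sign: "(-1) ^ k * \<sigma> * (-1) ^ r = - ((-1) ^ q)"
  proof -
    have "k + q * (N - 1) + r + q = 2 * (q * N + r) + 1"
      using N k by (cases N) auto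
    then have "(-1 :: complex) ^ (k + q * (N - 1) + r + q) = (-1) ^ (2 * (q * N + r) + 1)"
      by (rule arg_cong)
    then have "((-1) ^ k * \<sigma> * (-1) ^ r) * (-1) ^ q = -1"
      unfolding \<sigma>_def power_add power_mult[of _ 2] by simp
    moreover have "(-1 :: complex) ^ q * (-1) ^ q = 1" by (simp flip: power_mult_distrib)
    ultimately show ?thesis by (metis mult.assoc mult.right_neutral mult_minus1)
  qed
  have "root_sum N (\<lambda>j. unit_root N (int (k - 1) * j) *
        digamma_summand ((real N + real k - 1) / real N) (1 / real N) (unit_root N (- j) / X) n m)
      = root_sum N (\<lambda>j. 1 / (L * s ^ (k - 1)) * (1 / M * unit_root N (int (k - 1) * j)
          - unit_root N (int (k - 1) * j) / (M + Y * unit_root N (- j))))"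
    unfolding digamma_summand_def L_powr s_def[symmetric] M_def[symmetric]
    by (simp add: Y_def algebra_simps)
  also have "\<dots> = 1 / (L * s ^ (k - 1)) * (1 / M * root_sum N (\<lambda>j. unit_root N (int (k - 1) * j))
      - root_sum N (\<lambda>j. unit_root N (int (k - 1) * j) / (M + Y * unit_root N (- j))))"
    by (simp only: root_sum_distrib)
  also have "root_sum N (\<lambda>j. unit_root N (int (k - 1) * j)) = of_nat N * \<sigma> * \<delta>"
  proof -
    have "N dvd q * N + r \<longleftrightarrow> r = 0"
      using r by (auto simp: dvd_add_right_iff dest: dvd_imp_le)
    then show ?thesis
      using root_sum_unit_root_nat[OF N, of "k - 1"] N k by (auto simp: \<sigma>_def \<delta>_def)
  qed
  also have "root_sum N (\<lambda>j. unit_root N (int (k - 1) * j) / (M + Y * unit_root N (- j))) =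
      of_nat N * \<sigma> * (-1) ^ r * M ^ (N - 1 - r) * Y ^ r / (M ^ N + Y ^ N)"
    using root_sum_partial_fractions[OF r MY0, of q] k by (simp add: \<sigma>_def power_add mult_ac)
  finally have B1: "(-1) ^ k / of_nat N * X ^ (k - 1) *
      root_sum N (\<lambda>j. unit_root N (int (k - 1) * j) *
        digamma_summand ((real N + real k - 1) / real N) (1 / real N) (unit_root N (- j) / X) n m)
      = (-1) ^ k / of_nat N * X ^ (k - 1) * (1 / (L * s ^ (k - 1)) * (1 / M * (of_nat N * \<sigma> * \<delta>)
        - of_nat N * \<sigma> * (-1) ^ r * M ^ (N - 1 - r) * Y ^ r / (M ^ N + Y ^ N)))"
    by simp
  also have "\<dots> = ((-1) ^ k * \<sigma> * (-1) ^ r) * (X ^ (k - 1) / s ^ (k - 1)) / L *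
      (\<delta> / M - M ^ (N - 1 - r) * Y ^ r / (M ^ N + Y ^ N))"
  proof -
    have "1 / M * (of_nat N * \<sigma> * \<delta>) - of_nat N * \<sigma> * (-1) ^ r * M ^ (N - 1 - r) * Y ^ r / (M ^ N + Y ^ N)
        = of_nat N * (\<sigma> * (-1) ^ r) * (\<delta> / M - M ^ (N - 1 - r) * Y ^ r / (M ^ N + Y ^ N))"
      by (cases "r = 0") (simp_all add: \<delta>_def algebra_simps)
    then show ?thesis using N by (simp only:) (simp add: mult_ac)
  qed
  also have "X ^ (k - 1) / s ^ (k - 1) = (x / L) ^ q / Y ^ r"
  proof -
    have "X ^ (k - 1) / s ^ (k - 1) = (1 / Y) ^ (N * q + r)"
      using k by (simp add: Y_def power_divide mult.commute)
    also have "\<dots> = (1 / Y ^ N) ^ q * (1 / Y ^ r)"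
      by (simp only: power_add power_mult power_one_over)
    finally show ?thesis by (simp add: YN)
  qed
  also have "(-1) ^ k * \<sigma> * (-1) ^ r * ((x / L) ^ q / Y ^ r) / L *
      (\<delta> / M - M ^ (N - 1 - r) * Y ^ r / (M ^ N + Y ^ N)) =
      (- (x / L)) ^ q / L * (M ^ (N - 1 - r) / (M ^ N + Y ^ N) - \<delta> / M)"
  proof -
    \<comment> \<open>\<open>Y ^ r\<close> factors out in both cases: for r = 0 it is 1, and
      otherwise \<delta> = 0.\<close>
    have split: "\<delta> / M - M ^ (N - 1 - r) * Y ^ r / (M ^ N + Y ^ N) =
        Y ^ r * (\<delta> / M - M ^ (N - 1 - r) / (M ^ N + Y ^ N))"
      by (cases "r = 0") (simp_all add: \<delta>_def)
    have neg: "(- (x / L)) ^ q = (-1) ^ q * (x / L) ^ q" by (rule power_minus)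
    have alg: "- t * (y / z) / L * (z * (a - b)) = t * y / L * (b - a)" if "z \<noteq> 0" for t y z a b
      using that nz by (simp add: field_simps)
    show ?thesis unfolding sign split neg by (rule alg) (use nz in simp)
  qed
  also have "\<dots> = 1 / (M ^ k * L) * ((- v) ^ q * (v / (1 + v) - \<delta>))"
  proof -
    have vq: "(- v) ^ q = (- (x / L)) ^ q * M ^ (N * q)"
      unfolding power_mult power_mult_distrib[symmetric] by (simp add: v_def)
    have "N * q + N = N - 1 - r + k" using r k by (simp add: algebra_simps)
    then have "M ^ (N * q) * M ^ N = M ^ (N - 1 - r) * M ^ k" by (simp flip: power_add)
    then have "M ^ (N - 1 - r) / M ^ N = M ^ (N * q) / M ^ k"
      using nz by (simp add: field_simps)
    moreover have "M ^ (N - 1 - r) / (M ^ N * (1 + v) / v) = M ^ (N - 1 - r) / M ^ N * (v / (1 + v))"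
      by simp
    ultimately have frac: "M ^ (N - 1 - r) / (M ^ N + Y ^ N) = M ^ (N * q) / M ^ k * (v / (1 + v))"
      unfolding MY by argo
    \<comment> \<open>If \<delta> is not 0 then k = q N + 1, so the quotient of the two powers of
      \<open>M\<close> is 1 / M.\<close>
    have \<delta>_eq: "\<delta> / M = M ^ (N * q) / M ^ k * \<delta>"
      using nz k by (auto simp: \<delta>_def mult.commute)
    show ?thesis unfolding vq frac \<delta>_eq right_diff_distrib[symmetric] by (simp add: mult_ac)
  qed
  finally have B: "(-1) ^ k / of_nat N * X ^ (k - 1) *
      root_sum N (\<lambda>j. unit_root N (int (k - 1) * j) *
        digamma_summand ((real N + real k - 1) / real N) (1 / real N) (unit_root N (- j) / X) n m)
      = 1 / (M ^ k * L) * ((- v) ^ q * (v / (1 + v) - \<delta>))" .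
  have A: "digamma_summand (real k) (real N) x m n = 1 / (M ^ k * L) * (v / (1 + v))"
  proof -
    have "digamma_summand (real k) (real N) x m n = 1 / M ^ k * (1 / L - 1 / (L + M ^ N * x))"
      by (simp add: digamma_summand_def powr_realpow M_def L_def del: of_nat_Suc)
    also have "1 / L - 1 / (L + M ^ N * x) = M ^ N * x / (L * (L + M ^ N * x))"
      using nz sum_nz by (simp add: field_simps)
    also have "\<dots> = 1 / L * (v / (1 + v))"
    proof -
      have "1 + v = (L + M ^ N * x) / L" using nz by (simp add: v_def field_simps)
      then show ?thesis using nz by (simp add: v_def mult_ac)
    qed
    finally show ?thesis by simp
  qed
  have S: "(\<Sum>i=1..Q. (- x) ^ i * (1 / L ^ (1 + i)) * (1 / M ^ (k - N * i))) =
      1 / (M ^ k * L) * (\<Sum>i=1..Q. (- v) ^ i)"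
    unfolding sum_distrib_left
  proof (intro sum.cong refl)
    fix i assume "i \<in> {1..Q}"
    then have "i \<le> q" by (auto simp: Q_def split: if_splits)
    then have "i * N \<le> q * N" by (rule mult_le_mono1)
    then have "i * N \<le> k" using k(1) by linarith
    then have "N * i \<le> k" by (simp only: mult.commute)
    then have Mk: "M ^ k = M ^ (k - N * i) * M ^ (N * i)" by (metis le_add_diff_inverse2 power_add)
    have vi: "(- v) ^ i = (- x) ^ i * M ^ (N * i) / L ^ i"
      unfolding power_mult power_mult_distrib[symmetric] power_divide[symmetric] by (simp add: v_def)
    show "(- x) ^ i * (1 / L ^ (1 + i)) * (1 / M ^ (k - N * i)) = 1 / (M ^ k * L) * (- v) ^ i"
      unfolding Mk vi using nz by simp
  qed
  \<comment> \<open>Multiplying by (-v)^q shifts v / (1 + v) by a finite geometric sum. For r = 0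
    the subtracted 1 turns v / (1 + v) into -1 / (1 + v), which shortens that sum by one
    term.\<close>
  have geo: "v / (1 + v) = (- v) ^ q * (v / (1 + v) - \<delta>) - (\<Sum>i=1..Q. (- v) ^ i)"
  proof (cases "r = 0")
    case True
    then obtain q' where q': "q = Suc q'" using k by (cases q) auto
    have "v / (1 + v) - 1 = - 1 / (1 + v)" using v by (simp add: field_simps)
    then show ?thesis
      using True geometric_expansion[OF v(1), of q']
      by (simp add: q' Q_def \<delta>_def diff_divide_distrib add_divide_distrib)
  next
    case False
    then show ?thesis
      using geometric_expansion[OF v(1), of q]
      by (simp add: Q_def \<delta>_def diff_divide_distrib add_divide_distrib)
  qed
  have "c * t = c * a - c * b" if "t = a - b" for a b c t :: complex
    using that by (simp add: right_diff_distrib)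
  from this[OF geo] show ?thesis
    unfolding A B M_def[symmetric] L_def[symmetric] S .
qed

section \<open>The transformation formula\<close>

lemma has_sum_finite_sum:
  fixes f :: "'i \<Rightarrow> 'a \<Rightarrow> 'b :: topological_comm_monoid_add"
  assumes "\<And>i. i \<in> I \<Longrightarrow> (f i has_sum s i) A"
  shows "((\<lambda>a. \<Sum>i\<in>I. f i a) has_sum (\<Sum>i\<in>I. s i)) A"
  using assms by (induction I rule: infinite_finite_induct) (auto intro!: has_sum_add)

lemma zeta_product_has_sum:
  assumes "a > 1" "b > 1"
  shows "((\<lambda>(n, m). (1 / of_nat (Suc n) ^ a) * (1 / of_nat (Suc m) ^ b)) has_sum
    (zeta (of_nat a) * zeta (of_nat b))) (UNIV \<times> UNIV)"
proof -
  let ?f = "\<lambda>a n. 1 / (of_nat (Suc n) :: complex) ^ a"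
  have summ: "summable (\<lambda>n. norm (?f a n))" and f: "(?f a has_sum zeta (of_nat a)) UNIV" if "a > 1" for a
  proof -
    have pow: "real (Suc n) powr real a = real (Suc n) ^ a" for n
      by (rule powr_realpow) simp
    show *: "summable (\<lambda>n. norm (?f a n))"
      using summable_Suc_powr[of "real a"] that
      by (simp add: norm_divide norm_power pow del: of_nat_Suc)
    show "(?f a has_sum zeta (of_nat a)) UNIV"
      using zeta_sums[of "real a"] that
      by (intro norm_summable_imp_has_sum *) (simp add: pow del: of_nat_Suc)
  qed
  have abs: "(\<lambda>n. norm (?f a n)) summable_on UNIV" if "a > 1" for a
    using summ[OF that] by (intro norm_summable_imp_summable_on) simp
  have "(\<lambda>p. norm ((\<lambda>(n, m). ?f a n * ?f b m) p)) summable_on UNIV \<times> UNIV"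
    using abs_summable_on_product[OF abs[OF assms(1)] abs[OF assms(2)]] by (simp add: case_prod_unfold)
  then have "(\<lambda>(n, m). ?f a n * ?f b m) summable_on UNIV \<times> UNIV"
    by (rule Infinite_Sum.abs_summable_summable)
  moreover have "((\<lambda>m. case (n, m) of (n, m) \<Rightarrow> ?f a n * ?f b m) has_sum (?f a n * zeta (of_nat b))) UNIV" for n
    unfolding prod.case by (intro has_sum_cmult_right f assms)
  moreover have "((\<lambda>n. ?f a n * zeta (of_nat b)) has_sum (zeta (of_nat a) * zeta (of_nat b))) UNIV"
    by (intro has_sum_cmult_left f assms)
  ultimately show ?thesis by (intro has_sum_SigmaI)
qed

text \<open>The candidate logarithm has imaginary part -(\<pi> j + arg x) / N. From |j| \<le> N - 1
  and |arg x| < \<pi>/2 its absolute value is below \<pi>, so it is the principal one and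
  \<open>u\<close> avoids the cut.\<close>

lemma ln_rotated_root:
  fixes x :: complex
  assumes N: "N > 0" and j: "- (int N - 1) \<le> j" "j \<le> int N - 1" and x: "Re x > 0"
  defines "u \<equiv> unit_root N (- j) / x powr (1 / of_nat N)"
  shows "ln u = - (\<i> * of_real pi * of_int j / of_nat N) - ln x / of_nat N" and "u \<notin> \<real>\<^sub>\<le>\<^sub>0"
proof -
  define w where "w = - (\<i> * of_real pi * of_int j / of_nat N) - ln x / of_nat N"
  have x0: "x \<noteq> 0" using x by auto
  have u_exp: "u = exp w"
    using x0 by (simp add: u_def w_def unit_root_def powr_def exp_diff)
  have "\<bar>Im (ln x)\<bar> < pi / 2" using x Re_Ln_pos_lt[OF x0] by blast
  moreover have "\<bar>pi * of_int j\<bar> \<le> pi * (real N - 1)"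
  proof -
    have "\<bar>real_of_int j\<bar> \<le> real N - 1" using j by linarith
    then show ?thesis by (simp add: abs_mult)
  qed
  moreover have "Im w * real N = - (pi * of_int j) - Im (ln x)"
    using N by (simp add: w_def field_simps)
  ultimately have "\<bar>Im w * real N\<bar> < pi * real N"
    using pi_gt_zero by (simp add: right_diff_distrib)
  then have Im_w: "\<bar>Im w\<bar> < pi" using N by (simp add: abs_mult)
  then show ln_u: "ln u = - (\<i> * of_real pi * of_int j / of_nat N) - ln x / of_nat N"
    unfolding u_exp w_def[symmetric] by (intro Ln_exp) auto
  then have "Im (ln u) \<noteq> pi" using Im_w by (auto simp: w_def)
  moreover have "u \<noteq> 0" by (simp add: u_exp)
  ultimately show "u \<notin> \<real>\<^sub>\<le>\<^sub>0"
    using Im_Ln_eq_pi[of u] by (auto simp: complex_nonpos_Reals_iff complex_eq_iff)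
qed

text \<open>The termwise identity is summed over all pairs: each rotated double series converges
  absolutely, and each monomial in the two indices sums to a product of two zeta values.
  Unconditional summation allows the exchange of the indices.\<close>

lemma digamma_double_sum_transformation:
  fixes x :: complex
  assumes r: "r < N" and k: "k = q * N + r + 1" "k > 1" and x: "Re x > 0"
  defines "Q \<equiv> if r = 0 then q - 1 else q"
  defines "X \<equiv> x powr (1 / of_nat N)"
  shows "(\<Sum>\<^sub>\<infinity>(m, n)\<in>UNIV \<times> UNIV. digamma_summand (real k) (real N) x m n) =
    (-1) ^ k / of_nat N * X ^ (k - 1) *
      root_sum N (\<lambda>j. unit_root N (int (k - 1) * j) *
        (\<Sum>\<^sub>\<infinity>(n, m)\<in>UNIV \<times> UNIV. digamma_summand ((real N + real k - 1) / real N) (1 / real N)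
          (unit_root N (- j) / X) n m))
    - (\<Sum>i=1..Q. (- x) ^ i * (zeta (of_nat (1 + i)) * zeta (of_nat (k - N * i))))"
proof -
  have N: "N > 0" using r by simp
  define p where "p = (real N + real k - 1) / real N"
  have p: "p > 1" using N k(2) by (simp add: p_def field_simps)
  define D where "D = (\<lambda>j (n, m). digamma_summand p (1 / real N) (unit_root N (- j) / X) n m)"
  have D: "(D j has_sum infsum (D j) (UNIV \<times> UNIV)) (UNIV \<times> UNIV)"
    if "- (int N - 1) \<le> j" "j \<le> int N - 1" for j
  proof -
    have "unit_root N (- j) / X \<notin> \<real>\<^sub>\<le>\<^sub>0"
      unfolding X_def by (rule ln_rotated_root) (use N that x in auto)
    then have "(\<lambda>(n, m). norm (digamma_summand p (1 / real N) (unit_root N (- j) / X) n m))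
        summable_on UNIV \<times> UNIV"
      using N p by (intro digamma_summand_summable) auto
    then have "(\<lambda>z. norm (D j z)) summable_on UNIV \<times> UNIV"
      by (simp add: D_def case_prod_unfold)
    then show ?thesis
      by (intro has_sum_infsum) (rule Infinite_Sum.abs_summable_summable)
  qed
  have R: "((\<lambda>z. root_sum N (\<lambda>j. unit_root N (int (k - 1) * j) * D j z)) has_sum
      root_sum N (\<lambda>j. unit_root N (int (k - 1) * j) * infsum (D j) (UNIV \<times> UNIV))) (UNIV \<times> UNIV)"
    unfolding root_sum_def by (intro has_sum_finite_sum has_sum_cmult_right D) auto
  let ?T = "\<lambda>i (n, m). (1 / (of_nat (Suc n) :: complex) ^ (1 + i)) * (1 / of_nat (Suc m) ^ (k - N * i))"
  have T: "((\<lambda>z. \<Sum>i=1..Q. (- x) ^ i * ?T i z) has_sum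
      (\<Sum>i=1..Q. (- x) ^ i * (zeta (of_nat (1 + i)) * zeta (of_nat (k - N * i))))) (UNIV \<times> UNIV)"
  proof (intro has_sum_finite_sum has_sum_cmult_right zeta_product_has_sum)
    fix i assume i: "i \<in> {1..Q}"
    then show "1 < 1 + i" by simp
    \<comment> \<open>The choice of \<open>Q\<close> guarantees this: for r = 0 stopping at
      \<open>q - 1\<close> leaves at least N + 1, and for r > 0 the last exponent is r + 1.\<close>
    show "1 < k - N * i"
    proof (cases "r = 0")
      case True
      then have "i + 1 \<le> q" using i by (auto simp: Q_def)
      then have "(i + 1) * N \<le> q * N" by (rule mult_le_mono1)
      then show ?thesis using k True N by (simp add: algebra_simps)
    next
      case False
      then have "i * N \<le> q * N" using i by (intro mult_le_mono1) (auto simp: Q_def)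
      then have "k - i * N > 1" using k(1) False by linarith
      then show ?thesis by (simp only: mult.commute)
    qed
  qed
  have "((\<lambda>z. (-1) ^ k / of_nat N * X ^ (k - 1) *
        root_sum N (\<lambda>j. unit_root N (int (k - 1) * j) * D j z) - (\<Sum>i=1..Q. (- x) ^ i * ?T i z)) has_sum
      ((-1) ^ k / of_nat N * X ^ (k - 1) *
        root_sum N (\<lambda>j. unit_root N (int (k - 1) * j) * infsum (D j) (UNIV \<times> UNIV))
      - (\<Sum>i=1..Q. (- x) ^ i * (zeta (of_nat (1 + i)) * zeta (of_nat (k - N * i)))))) (UNIV \<times> UNIV)"
    unfolding diff_conv_add_uminus by (intro has_sum_add has_sum_uminusI has_sum_cmult_right R T)
  also have "(\<lambda>z. (-1) ^ k / of_nat N * X ^ (k - 1) *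
        root_sum N (\<lambda>j. unit_root N (int (k - 1) * j) * D j z) - (\<Sum>i=1..Q. (- x) ^ i * ?T i z)) =
      (\<lambda>(n, m). digamma_summand (real k) (real N) x m n)"
  proof (rule ext)
    fix z :: "nat \<times> nat"
    obtain n m where z: "z = (n, m)" by (cases z)
    show "(-1) ^ k / of_nat N * X ^ (k - 1) *
        root_sum N (\<lambda>j. unit_root N (int (k - 1) * j) * D j z) - (\<Sum>i=1..Q. (- x) ^ i * ?T i z)
      = (\<lambda>(n, m). digamma_summand (real k) (real N) x m n) z"
      unfolding z digamma_summand_decomposition[OF r k x, of m n] Q_def X_def D_def p_def prod.case
      by (simp only: mult.assoc)
  qed
  finally have "((\<lambda>(m, n). digamma_summand (real k) (real N) x m n) has_sum
      ((-1) ^ k / of_nat N * X ^ (k - 1) *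
        root_sum N (\<lambda>j. unit_root N (int (k - 1) * j) * infsum (D j) (UNIV \<times> UNIV))
      - (\<Sum>i=1..Q. (- x) ^ i * (zeta (of_nat (1 + i)) * zeta (of_nat (k - N * i)))))) (UNIV \<times> UNIV)"
    by (subst has_sum_swap) (simp add: case_prod_unfold)
  then show ?thesis
    unfolding D_def p_def by (rule infsumI)
qed

section \<open>Assembling the formula and the three cases of the residue\<close>

lemma root_sum_of_int: "root_sum N of_int = 0"
proof -
  have "(\<Sum>l<N. 2 * int l - (int N - 1)) = 0"
    by (induction N) (simp_all add: sum_subtractf sum.distrib algebra_simps flip: sum_distrib_left)
  then have "(of_int (\<Sum>l<N. 2 * int l - (int N - 1)) :: complex) = 0" by simp
  then show ?thesis by (simp add: root_sum_def)
qed

theorem theorem2p5: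
  fixes k N :: nat and x :: complex
  assumes "k > 1" and "N > 1" and "Re x > 0"
  shows "herglotz (real k) (real N) x =
    (-1) ^ k / of_nat N * x powr ((of_nat k - 1) / of_nat N) *
      (\<Sum>j | j \<in> {- (int N - 1)..int N - 1} \<and> [j = int N - 1] (mod 2).
         exp (\<i> * of_real pi * of_int j * (of_nat k - 1) / of_nat N) *
         herglotz ((real N + real k - 1) / real N) (1 / real N)
           (exp (- (\<i> * of_real pi * of_int j / of_nat N)) / x powr (1 / of_nat N)))
    - x powr ((of_nat k - 1) / of_nat N) / of_nat N * herglotz_residue N k x"
proof -
  define q r where "q = (k - 1) div N" and "r = (k - 1) mod N"
  have N: "N > 0" and r: "r < N" and k: "k = q * N + r + 1"
    using assms by (auto simp: q_def r_def)
  have x0: "x \<noteq> 0" using assms by auto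
  define Q where "Q = (if r = 0 then q - 1 else q)"
  \<comment> \<open>Every power of \<open>x\<close> in the formula becomes \<open>X\<close>,
    \<open>P\<close> or 1 / P times an integral power of \<open>x\<close>, so the final comparison
    is purely algebraic.\<close>
  define X P where "X = x powr (1 / of_nat N)" and "P = X ^ (k - 1)"
  define p where "p = (real N + real k - 1) / real N"
  define e u where "e = (\<lambda>j. unit_root N (int (k - 1) * j))" and "u = (\<lambda>j. unit_root N (- j) / X)"
  define S where "S = (\<lambda>j. \<Sum>\<^sub>\<infinity>(n, m)\<in>UNIV \<times> UNIV. digamma_summand p (1 / real N) (u j) n m)"
  define T where "T = (\<Sum>i=1..Q. (- x) ^ i * (zeta (of_nat (1 + i)) * zeta (of_nat (k - N * i))))"
  define Z Z' Z2 where "Z = zeta (of_real p)" and "Z' = deriv zeta (of_real p)"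
    and "Z2 = zeta (of_real (p + 1 / real N))"
  have nz: "X \<noteq> 0" "P \<noteq> 0" using x0 by (simp_all add: X_def P_def)
  have p: "p > 1" using assms by (simp add: p_def field_simps)

  have P_powr: "x powr ((of_nat k - 1) / of_nat N) = P"
    using assms by (simp add: P_def X_def powr_def of_nat_diff flip: exp_of_nat_mult)
  have P_inv: "x powr ((1 - of_nat k) / of_nat N) = 1 / P"
  proof -
    have "(1 - of_nat k) / of_nat N = - ((of_nat k - 1) / of_nat N :: complex)"
      by (simp add: diff_divide_distrib)
    then show ?thesis by (simp add: powr_minus P_powr inverse_eq_divide)
  qed
  have P_inv_x: "x powr ((1 - of_nat k - of_nat N) / of_nat N) = 1 / (P * x)"
  proof -
    have "(1 - of_nat k - of_nat N) / of_nat N = (1 - of_nat k) / of_nat N - (1 :: complex)"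
      using N by (simp add: diff_divide_distrib)
    then show ?thesis using x0 by (simp add: powr_diff P_inv)
  qed
  have P_inv_pow: "x powr ((1 - of_nat k) / of_nat N + of_nat j) = x ^ j / P" for j
    using x0 by (simp add: powr_add P_inv)
  have p_arg: "(of_nat N + of_nat k - 1) / of_nat N = complex_of_real p"
    by (simp add: p_def)
  have p_arg2: "(of_nat k + of_nat N) / of_nat N = complex_of_real (p + 1 / real N)"
    by (simp add: p_def add_divide_distrib diff_divide_distrib)

  have herglotz_u: "herglotz p (1 / real N) (u j) = S j + Z' / of_nat N
      - (euler_mascheroni - \<i> * of_real pi * of_int j / of_nat N - ln x / of_nat N) * Z - Z2 / (2 * u j)"
    if "- (int N - 1) \<le> j" "j \<le> int N - 1" for j
  proof -
    have ln_u: "ln (u j) = - (\<i> * of_real pi * of_int j / of_nat N) - ln x / of_nat N" "u j \<notin> \<real>\<^sub>\<le>\<^sub>0"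
      unfolding u_def X_def by (rule ln_rotated_root; use N that assms in simp)+
    show ?thesis
      using herglotz_expansion[OF p _ ln_u(2), of "1 / real N"] N
      by (simp add: S_def Z_def Z'_def Z2_def ln_u(1))
  qed
  define G where "G = (\<lambda>h. root_sum N (\<lambda>j. unit_root N (int h * j)))"
  define J where "J = root_sum N (\<lambda>j. of_int j * e j)"
  \<comment> \<open>Apart from \<open>S j\<close>, the expansion depends on \<open>j\<close> through
    a constant, a term linear in \<open>j\<close> from the logarithm, and 1 / u j. Against the
    weights these give \<open>G (k - 1)\<close>, \<open>J\<close> and \<open>G k\<close>.\<close>
  have root_sum_herglotz: "root_sum N (\<lambda>j. e j * herglotz p (1 / real N) (u j)) =
      root_sum N (\<lambda>j. e j * S j) + ((Z' / of_nat N - euler_mascheroni * Z + Z * ln x / of_nat N) * G (k - 1)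
        + \<i> * of_real pi / of_nat N * Z * J - Z2 / 2 * X * G k)"
  proof -
    have e_u: "e j / u j = X * unit_root N (int k * j)" for j
    proof -
      have "int k * j = int (k - 1) * j + j" using assms by (simp add: of_nat_diff algebra_simps)
      then show ?thesis
        using unit_root_add[of N "int (k - 1) * j" j] by (simp add: e_def u_def unit_root_minus mult_ac)
    qed
    have "root_sum N (\<lambda>j. e j * herglotz p (1 / real N) (u j)) =
      root_sum N (\<lambda>j. e j * S j + ((Z' / of_nat N - euler_mascheroni * Z + Z * ln x / of_nat N) * e j
        + \<i> * of_real pi / of_nat N * Z * (of_int j * e j) - Z2 / 2 * X * unit_root N (int k * j)))"
    proof (rule root_sum_cong)
      fix j assume j: "- (int N - 1) \<le> j" "j \<le> int N - 1"
      have "Z2 / 2 * X * unit_root N (int k * j) = Z2 / 2 * (e j / u j)" by (simp add: e_u)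
      then show "e j * herglotz p (1 / real N) (u j) =
        e j * S j + ((Z' / of_nat N - euler_mascheroni * Z + Z * ln x / of_nat N) * e j
        + \<i> * of_real pi / of_nat N * Z * (of_int j * e j) - Z2 / 2 * X * unit_root N (int k * j))"
        unfolding herglotz_u[OF j] by (simp add: algebra_simps)
    qed
    then show ?thesis
      unfolding G_def J_def e_def[symmetric] by (simp only: root_sum_distrib)
  qed

  \<comment> \<open>\<open>W\<close> is the part of the residue whose form changes between the three
    cases; otherwise only the length \<open>Q\<close> of the finite sum varies.\<close>
  define W where "W = (-1) ^ k * ((Z' / of_nat N - euler_mascheroni * Z + Z * ln x / of_nat N) * G (k - 1)
        + \<i> * of_real pi / of_nat N * Z * J - Z2 / 2 * X * G k)"
  have T_eq: "of_nat N * (\<Sum>j = 1..Q. (-1) ^ j * zeta (1 + of_nat j) * zeta (of_nat k - of_nat N * of_nat j) *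
           x powr ((1 - of_nat k) / of_nat N + of_nat j)) = of_nat N * T / P"
  proof -
    have "(-1) ^ i * zeta (1 + of_nat i) * zeta (of_nat k - of_nat N * of_nat i) * (x ^ i / P) =
        (- x) ^ i * (zeta (of_nat (1 + i)) * zeta (of_nat (k - N * i))) / P" if "i \<in> {1..Q}" for i
    proof -
      have "i \<le> q" using that by (auto simp: Q_def split: if_splits)
      then have "i * N \<le> q * N" by (rule mult_le_mono1)
      then have "i * N \<le> k" using k by linarith
      then have "N * i \<le> k" by (simp only: mult.commute)
      then have "of_nat k - of_nat N * of_nat i = (of_nat (k - N * i) :: complex)"
        by (simp add: of_nat_diff)
      then show ?thesis by (simp add: power_minus[of x] mult_ac)
    qed
    then have "(\<Sum>i = 1..Q. (-1) ^ i * zeta (1 + of_nat i) * zeta (of_nat k - of_nat N * of_nat i) *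
        (x ^ i / P)) = T / P"
      unfolding T_def sum_divide_distrib by (intro sum.cong refl)
    then show ?thesis unfolding P_inv_pow by simp
  qed

  have residue: "herglotz_residue N k x = of_nat N / 2 * (1 / (P * x)) * zeta (of_nat k + of_nat N) + W
      - of_nat N * (1 / P) * (of_nat N * deriv zeta (of_nat k) - (euler_mascheroni + ln x) * zeta (of_nat k))
      + of_nat N * T / P"
  proof -
    have G_eq: "G h = (if N dvd h then of_nat N * (-1) ^ (h div N * (N - 1)) else 0)" for h
      unfolding G_def by (rule root_sum_unit_root_nat[OF N])
    have not_both: "\<not> N dvd k" if "N dvd k - 1"
      using that assms dvd_diff_nat[of N k "k - 1"] by auto
    have dvd_r: "N dvd k - 1 \<longleftrightarrow> r = 0" by (simp add: r_def dvd_eq_mod_eq_0)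
    have J_eq: "(-1) ^ k * (\<i> * of_real pi / of_nat N * Z * J) =
        - (of_real pi * Z / sin (of_real pi / of_nat N * (of_nat k - 1)))" if "\<not> N dvd k - 1"
    proof -
      have "\<not> int N dvd int (k - 1)" using that unfolding int_dvd_int_iff .
      from root_sum_index_times_unit_root[OF N this]
      have "J = - \<i> * of_nat N * (if even (k - 1) then 1 else -1)
          / sin (of_real pi / of_nat N * of_nat (k - 1))"
        by (simp only: J_def e_def even_of_nat of_int_of_nat_eq)
      moreover have "of_nat (k - 1) = (of_nat k - 1 :: complex)" using assms by (simp add: of_nat_diff)
      moreover have "even (k - 1) \<longleftrightarrow> odd k" using assms by simp
      ultimately have "J = - \<i> * of_nat N * (if odd k then 1 else -1)
          / sin (of_real pi / of_nat N * (of_nat k - 1))" by (simp only:)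
      then show ?thesis using N by (cases "even k") (simp_all add: mult_ac)
    qed
    consider "N dvd k - 1" | "\<not> N dvd k - 1" "N dvd k" | "\<not> N dvd k - 1" "\<not> N dvd k" by blast
    then show ?thesis
    proof cases
      case 1
      then have "r = 0" using dvd_r by blast
      \<comment> \<open>The sine of \<pi> (k - 1) / N vanishes in this case, so \<open>J_eq\<close>
        cannot be used. The weights are instead one constant sign on the whole index set, and that
        set is symmetric about 0.\<close>
      have "J = 0"
      proof -
        have "e j = (if even (q * (N - 1)) then 1 else -1)"
          if "even (j - (int N - 1))" for j
        proof -
          have "e j = unit_root N (int N * (int q * j))"
            using k \<open>r = 0\<close> by (simp add: e_def mult_ac)
          moreover have "even (int q * j) \<longleftrightarrow> even (q * (N - 1))"
            using that N by (auto simp: even_diff)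
          ultimately show ?thesis using unit_root_mult_self[OF N, of "int q * j"] by simp
        qed
        then have "J = root_sum N (\<lambda>j. (if even (q * (N - 1)) then 1 else -1) * of_int j)"
          unfolding J_def by (intro root_sum_cong) simp
        also have "\<dots> = 0"
          unfolding root_sum_distrib(1)[symmetric] by (simp add: root_sum_of_int)
        finally show ?thesis .
      qed
      have "(-1) ^ k * G (k - 1) = - (of_nat N * (-1) ^ q)"
      proof -
        have "G (k - 1) = of_nat N * (-1) ^ (q * (N - 1))" using 1 by (simp add: G_eq q_def)
        moreover have "(-1 :: complex) ^ k * (-1) ^ (q * (N - 1)) = - ((-1) ^ q)"
        proof -
          have "k + q * (N - 1) + q = 2 * (q * N) + 1" using k \<open>r = 0\<close> N by (cases N) auto
          then have "even (k + q * (N - 1)) \<longleftrightarrow> odd q" by presburger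
          then show ?thesis unfolding power_add[symmetric] unfolding minus_one_power_iff by (simp only:) simp
        qed
        ultimately show ?thesis by (simp add: mult_ac)
      qed
      moreover have "G k = 0" using not_both[OF 1] by (simp add: G_eq)
      ultimately have "W = (-1) ^ q * ((of_nat N * euler_mascheroni - ln x) * Z - Z')"
        unfolding W_def \<open>J = 0\<close> using N by (simp add: field_simps)
      moreover have "Q = (k - 1) div N - 1" using \<open>r = 0\<close> by (simp add: Q_def q_def)
      ultimately show ?thesis
        unfolding herglotz_residue_def T_eq[symmetric] P_inv P_inv_x p_arg using 1
        by (simp add: Z_def Z'_def q_def)
    next
      case 2
      \<comment> \<open>Of the three root sums \<open>G (k - 1)\<close> vanishes here, while
        \<open>G k\<close> survives and yields the additional term with x^(1/N).\<close>
      have "(-1) ^ k * G k = of_nat N * (-1) ^ (k div N)"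
      proof -
        obtain c where c: "k = N * c" using 2 by blast
        have "(-1 :: complex) ^ k * (-1) ^ (c * (N - 1)) = (-1) ^ c"
        proof -
          have "k + c * (N - 1) + c = 2 * k" using c N by (cases N) auto
          then have "even (k + c * (N - 1)) \<longleftrightarrow> even c" by presburger
          then show ?thesis unfolding power_add[symmetric] unfolding minus_one_power_iff by (simp only:)
        qed
        then show ?thesis using 2 N c by (simp add: G_eq)
      qed
      moreover have "G (k - 1) = 0" using 2 by (simp add: G_eq)
      ultimately have "W = - (of_real pi * Z / sin (of_real pi / of_nat N * (of_nat k - 1)))
          - of_nat N / 2 * (-1) ^ (k div N) * X * Z2"
        using J_eq[OF 2(1)] unfolding W_def by (simp add: algebra_simps)
      moreover have "r \<noteq> 0" using 2 dvd_r by blast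
      then have "Q = (k - 1) div N" by (simp add: Q_def q_def)
      ultimately show ?thesis
        unfolding herglotz_residue_def T_eq[symmetric] P_inv P_inv_x p_arg p_arg2 X_def[symmetric]
        using 2 by (simp add: Z_def Z2_def)
    next
      case 3
      then have "G (k - 1) = 0" "G k = 0" by (simp_all add: G_eq)
      then have "W = - (of_real pi * Z / sin (of_real pi / of_nat N * (of_nat k - 1)))"
        using J_eq[OF 3(1)] unfolding W_def by simp
      moreover have "r \<noteq> 0" using 3 dvd_r by blast
      then have "Q = (k - 1) div N" by (simp add: Q_def q_def)
      ultimately show ?thesis
        unfolding herglotz_residue_def T_eq[symmetric] P_inv P_inv_x p_arg using 3
        by (simp add: Z_def)
    qed
  qed

  have "x \<notin> \<real>\<^sub>\<le>\<^sub>0" using assms by (auto simp: complex_nonpos_Reals_iff)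
  then have "herglotz (real k) (real N) x =
      (-1) ^ k / of_nat N * P * root_sum N (\<lambda>j. e j * S j) - T
      + of_nat N * deriv zeta (of_nat k) - (euler_mascheroni + ln x) * zeta (of_nat k)
      - zeta (of_nat k + of_nat N) / (2 * x)"
    using herglotz_expansion[of "real k" "real N" x]
      digamma_double_sum_transformation[OF r k assms(1,3)] assms
    by (simp add: P_def X_def S_def T_def Q_def e_def u_def p_def)
  also have "\<dots> = (-1) ^ k / of_nat N * P * root_sum N (\<lambda>j. e j * herglotz p (1 / real N) (u j))
      - P / of_nat N * herglotz_residue N k x"
  proof -
    have alg: "c / d * P * R - T + d * z' - g * z - y / (2 * x) =
        c / d * P * (R + w) - P / d * (d / 2 * (1 / (P * x)) * y + c * w - d * (1 / P) * (d * z' - g * z) + d * T / P)"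
      if "d \<noteq> 0" for c d R w z' g z y :: complex
      using that nz x0 by (simp add: field_simps)
    show ?thesis
      unfolding residue root_sum_herglotz W_def by (rule alg) (use N in simp)
  qed
  also have "root_sum N (\<lambda>j. e j * herglotz p (1 / real N) (u j)) =
      (\<Sum>j | j \<in> {- (int N - 1)..int N - 1} \<and> [j = int N - 1] (mod 2).
         exp (\<i> * of_real pi * of_int j * (of_nat k - 1) / of_nat N) *
         herglotz ((real N + real k - 1) / real N) (1 / real N)
           (exp (- (\<i> * of_real pi * of_int j / of_nat N)) / x powr (1 / of_nat N)))"
    unfolding sum_parity_interval[OF N] root_sum_def
    using assms by (intro sum.cong refl)
      (simp add: e_def u_def X_def p_def unit_root_def of_nat_diff mult_ac)
  finally show ?thesis unfolding P_powr .
qed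

end
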